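(* For every integer $k\geq 2$, $\mathcal{S}_{3s}(1,k)=\mathbb{N}\setminus\{1\}$.
   Context: Let $V$ be a set of $v$ elements and let $k,t$ be positive integers with $t<k<v$. A block is a $k$-subset of $V$. A $\mu$-way $(v,k,t)$ trade of volume $m$ is a family $T=\{T_1,\dots,T_\mu\}$ of $\mu$ pairwise disjoint collections of blocks, each $T_i$ consisting of exactly $m$ blocks, such that for every $t$-subset $S$ of $V$, the number of blocks of $T_i$ containing $S$ is the same for all $i$. It is a Steiner trade if every $t$-subset of $V$ is contained in at most one block of each $T_i$. $\mathcal{S}_{\mu s}(t,k)$ denotes the set of all positive integers $m$ such that a $\mu$-way $(v,k,t)$ Steiner trade of volume $m$ exists for some $v$. Here $\mathbb{N}=\{1,2,3,\dots\}$. *)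

theory Defs
  imports Main "HOL-Library.Disjoint_Sets" "HOL-Library.Ramsey"
begin

text \<open>
  A \<open>\<mu>\<close>-way \<open>(v,k,t)\<close> trade of volume \<open>m\<close> on the point set \<open>V\<close>, where \<open>v = card V\<close>.
  The family is indexed by \<open>i < \<mu>\<close>; \<open>nsets V k\<close> is the set of all \<open>k\<close>-subsets of \<open>V\<close>.
\<close>

definition way_trade ::
  "nat \<Rightarrow> 'a set \<Rightarrow> nat \<Rightarrow> nat \<Rightarrow> nat \<Rightarrow> (nat \<Rightarrow> 'a set set) \<Rightarrow> bool" where
  "way_trade \<mu> V k t m T \<longleftrightarrow>
     finite V \<and> 0 < t \<and> t < k \<and> k < card V \<and>
     (\<forall>i<\<mu>. T i \<subseteq> nsets V k \<and> card (T i) = m) \<and>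
     disjoint_family_on T {..<\<mu>} \<and>
     (\<forall>S \<in> nsets V t. \<forall>i<\<mu>. \<forall>j<\<mu>.
        card {B \<in> T i. S \<subseteq> B} = card {B \<in> T j. S \<subseteq> B})"

definition steiner_way_trade ::
  "nat \<Rightarrow> 'a set \<Rightarrow> nat \<Rightarrow> nat \<Rightarrow> nat \<Rightarrow> (nat \<Rightarrow> 'a set set) \<Rightarrow> bool" where
  "steiner_way_trade \<mu> V k t m T \<longleftrightarrow>
     way_trade \<mu> V k t m T \<and>
     (\<forall>S \<in> nsets V t. \<forall>i<\<mu>. card {B \<in> T i. S \<subseteq> B} \<le> 1)"

text \<open>
  The set \<open>\<S>\<^sub>\<mu>\<^sub>s(t,k)\<close>. Since \<open>v\<close> ranges over all sizes, it suffices to let \<open>V\<close> range over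
  the finite sets of natural numbers: every finite point set is in bijection with one of them.
\<close>

definition steiner_volumes :: "nat \<Rightarrow> nat \<Rightarrow> nat \<Rightarrow> nat set" where
  "steiner_volumes \<mu> t k =
     {m. 0 < m \<and> (\<exists>(V :: nat set) T. steiner_way_trade \<mu> V k t m T)}"

end

theory Submission
  imports Defs "HOL-Combinatorics.Transposition" "HOL-Number_Theory.Cong"
begin

text \<open>
  A Steiner trade with \<open>t = 1\<close> is a family of pairwise disjoint partitions of one point set into
  \<open>k\<close>-sets. For \<open>m \<ge> 3\<close> arrange the points \<open>{..<m * k}\<close> as an array with \<open>m\<close> rows (the residues
  modulo \<open>m\<close>) and \<open>k\<close> columns, and rotate the first column by \<open>0\<close>, \<open>1\<close> and \<open>2\<close> rows: the rows of
  the three resulting arrays are the three partitions. For \<open>m = 2\<close> the last rotation is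
  trivial and is replaced by the exchange of the points \<open>1\<close> and \<open>2\<close>, which lie in different
  rows and columns. A volume of \<open>1\<close> is impossible because the only block of each collection is
  the set of covered points.
\<close>

text \<open>Each point of \<open>V\<close> lies in exactly one fibre of \<open>f s\<close>, so every
  singleton is covered exactly once by every collection; this yields the balance and the Steiner
  condition together. By symmetry, distinctness of fibres is only asked for
  \<open>s < s'\<close>.\<close>

lemma steiner_way_trade_fibres:
  fixes f :: "nat \<Rightarrow> 'a \<Rightarrow> nat"
  assumes V: "finite V" and k: "1 < k" "k < card V"
    and lab: "\<And>s x. s < \<mu> \<Longrightarrow> x \<in> V \<Longrightarrow> f s x < m"
    and fib: "\<And>s i. s < \<mu> \<Longrightarrow> i < m \<Longrightarrow> card {x \<in> V. f s x = i} = k"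
    and ne: "\<And>s s' i i'. s < s' \<Longrightarrow> s' < \<mu> \<Longrightarrow> i < m \<Longrightarrow> i' < m \<Longrightarrow>
               {x \<in> V. f s x = i} \<noteq> {x \<in> V. f s' x = i'}"
  shows "steiner_way_trade \<mu> V k 1 m (\<lambda>s. (\<lambda>i. {x \<in> V. f s x = i}) ` {..<m})"
    (is "steiner_way_trade _ _ _ _ _ ?T")
proof -
  have inj: "inj_on (\<lambda>i. {x \<in> V. f s x = i}) {..<m}" if "s < \<mu>" for s
  proof (rule inj_onI)
    fix i j assume "i \<in> {..<m}" "j \<in> {..<m}"
      and eq: "{x \<in> V. f s x = i} = {x \<in> V. f s x = j}"
    then have "{x \<in> V. f s x = i} \<noteq> {}"
      using fib[OF that, of i] k by (metis card.empty lessThan_iff not_less_zero)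
    with eq show "i = j" by blast
  qed
  have ds: "?T s \<inter> ?T s' = {}" if "s < s'" "s' < \<mu>" for s s'
    using ne[OF that] by fastforce
  have one: "card {B \<in> ?T s. S \<subseteq> B} = 1" if "S \<in> nsets V 1" "s < \<mu>" for S s
  proof -
    from that obtain x where x: "S = {x}" "x \<in> V"
      by (auto simp: nsets_def card_1_singleton_iff)
    have "{B \<in> ?T s. S \<subseteq> B} = {{y \<in> V. f s y = f s x}}"
      using x lab[OF that(2) x(2)] by auto
    then show ?thesis by simp
  qed
  have "?T s \<subseteq> nsets V k" if "s < \<mu>" for s
    using fib[OF that] V by (auto simp: nsets_def)
  moreover have "card (?T s) = m" if "s < \<mu>" for s
    using card_image[OF inj[OF that]] by simp
  moreover have "disjoint_family_on ?T {..<\<mu>}"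
  proof (unfold disjoint_family_on_def, intro ballI impI)
    fix s s' assume "s \<in> {..<\<mu>}" "s' \<in> {..<\<mu>}" "s \<noteq> s'"
    then show "?T s \<inter> ?T s' = {}"
      using ds[of s s'] ds[of s' s] by (cases s s' rule: linorder_cases) (simp_all add: Int_commute)
  qed
  ultimately show ?thesis
    using V k one unfolding steiner_way_trade_def way_trade_def by simp
qed

lemma card_residue_class:
  fixes i m k :: nat
  assumes "i < m"
  shows "card {x \<in> {..<m * k}. x mod m = i} = k"
proof -
  have "{x \<in> {..<m * k}. x mod m = i} = (\<lambda>j. m * j + i) ` {..<k}"
  proof (intro equalityI subsetI)
    fix x assume "x \<in> {x \<in> {..<m * k}. x mod m = i}"
    then have "x = m * (x div m) + i" "x div m < k"
      by (auto simp: less_mult_imp_div_less mult.commute)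
    then show "x \<in> (\<lambda>j. m * j + i) ` {..<k}" by blast
  next
    fix x assume "x \<in> (\<lambda>j. m * j + i) ` {..<k}"
    then obtain j where j: "x = m * j + i" "j < k" by blast
    \<comment> \<open>Since \<open>i < m\<close>, the point \<open>m * j + i\<close> lies below
      \<open>m * Suc j\<close>.\<close>
    then have "m * Suc j \<le> m * k" by (intro mult_le_mono2) simp
    with j assms show "x \<in> {x \<in> {..<m * k}. x mod m = i}" by simp
  qed
  moreover have "inj_on (\<lambda>j. m * j + i) {..<k}"
    using assms by (auto simp: inj_on_def)
  ultimately show ?thesis by (simp add: card_image)
qed

text \<open>The permutation \<open>p\<close> carries this fibre bijectively onto the residue class
  of \<open>i\<close>.\<close>

lemma card_residue_class_permuted:
  fixes i m k :: nat
  assumes "bij_betw p {..<m * k} {..<m * k}" "i < m"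
  shows "card {x \<in> {..<m * k}. p x mod m = i} = k"
proof -
  have "p ` {x \<in> {..<m * k}. p x mod m = i} = {x \<in> {..<m * k}. x mod m = i}"
    using assms(1) by (auto simp: bij_betw_def)
  moreover have "inj_on p {x \<in> {..<m * k}. p x mod m = i}"
    using assms(1) by (auto simp: bij_betw_def intro: inj_on_subset)
  ultimately show ?thesis
    using card_image[of p "{x \<in> {..<m * k}. p x mod m = i}"] card_residue_class[OF assms(2), of k]
    by simp
qed

text \<open>The row of a point is its residue modulo \<open>m\<close>, and the first column consists
  of the points below \<open>m\<close>.\<close>

definition rotate_column :: "nat \<Rightarrow> nat \<Rightarrow> nat \<Rightarrow> nat" where
  "rotate_column m s x = (if x < m then (x + s) mod m else x)"

lemma bij_betw_rotate_column:
  assumes "0 < k"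
  shows "bij_betw (rotate_column m s) {..<m * k} {..<m * k}"
proof -
  have le: "m \<le> m * k" using assms by simp
  have lt: "(x + s) mod m < m" if "x < m" for x using that by simp
  have "x = y" if "x < m" "y < m" "(x + s) mod m = (y + s) mod m" for x y
    using that cong_add_rcancel_nat[of x s y m] by (simp add: unique_euclidean_semiring_class.cong_def)
  then have "inj_on (rotate_column m s) {..<m * k}"
    using lt unfolding inj_on_def rotate_column_def by (metis (full_types))
  moreover have "rotate_column m s ` {..<m * k} \<subseteq> {..<m * k}"
    using less_le_trans[OF lt le] unfolding rotate_column_def by auto
  ultimately show ?thesis
    by (simp add: bij_betw_def endo_inj_surj)
qed

lemma steiner_way_trade_rotations:
  assumes "3 \<le> m" "2 \<le> k"
  shows "\<exists>T. steiner_way_trade 3 {..<m * k} k 1 m T"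
proof -
  define f where "f s x = rotate_column m s x mod m" for s x
  have small: "f s x = (x + s) mod m" if "x < m" for s x
    using that by (simp add: f_def rotate_column_def)
  have cols: "m + x < m * k" if "x < m" for x
    using that mult_le_mono2[OF assms(2), of m] by linarith
  have "{x \<in> {..<m * k}. f s x = i} \<noteq> {x \<in> {..<m * k}. f s' x = i'}"
    if s: "s < s'" "s' < 3" and i: "i < m" "i' < m" for s s' i i'
  proof
    assume eq: "{x \<in> {..<m * k}. f s x = i} = {x \<in> {..<m * k}. f s' x = i'}"
    \<comment> \<open>The point of the second column in row \<open>i\<close> is fixed by every
      rotation, so a common block must carry the same label on both sides.\<close>
    have "m + i \<in> {x \<in> {..<m * k}. f s x = i}"
      using i cols by (simp add: f_def rotate_column_def)
    then have "f s' (m + i) = i'" unfolding eq by simp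
    then have "i' = i" using i by (simp add: f_def rotate_column_def)
    \<comment> \<open>This is the first-column point that the rotation by \<open>s\<close> brings to
      row \<open>i\<close>; \<open>m - s\<close> stands for \<open>-s\<close> modulo
      \<open>m\<close>.\<close>
    define x where "x = (i + (m - s)) mod m"
    have x: "x < m" using assms by (simp add: x_def)
    have "f s x = (i + (m - s) + s) mod m"
      unfolding small[OF x] by (simp only: x_def mod_add_left_eq)
    also have "\<dots> = i" using s assms i by simp
    finally have "f s x = i" .
    moreover have "x < m * k" using cols[OF x] by simp
    ultimately have "x \<in> {x \<in> {..<m * k}. f s x = i}" by simp
    then have "f s' x = i" unfolding eq using \<open>i' = i\<close> by simp
    with \<open>f s x = i\<close> have "(s + x) mod m = (s' + x) mod m"
      by (simp add: small[OF x] add.commute)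
    then have "s mod m = s' mod m"
      using cong_add_rcancel_nat[of s x s' m] by (simp add: unique_euclidean_semiring_class.cong_def)
    \<comment> \<open>Both shifts are at most 2, hence below \<open>m\<close>, so distinct shifts
      have distinct residues.\<close>
    then show False using s assms by simp
  qed
  moreover have "card {x \<in> {..<m * k}. f s x = i} = k" if "i < m" for s i
    unfolding f_def using that assms
    by (intro card_residue_class_permuted bij_betw_rotate_column) auto
  moreover have "f s x < m" for s x
    using assms by (simp add: f_def)
  moreover have "k < m * k" using assms by simp
  ultimately show ?thesis
    using assms steiner_way_trade_fibres[of "{..<m * k}" k 3 f m] by auto
qed

lemma steiner_way_trade_volume_two:
  assumes "2 \<le> k"
  shows "\<exists>T. steiner_way_trade 3 {..<2 * k} k 1 2 T"
proof -
  define p where "p s = (if s = 2 then transpose 1 2 else rotate_column 2 s)" for s :: nat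
  define f where "f s x = p s x mod 2" for s x
  \<comment> \<open>On the first two columns the three labellings induce the three perfect matchings
    of four points: 02|13, 12|03 and 01|23. No pair recurs, so these four points already tell all
    fibres apart.\<close>
  have vals: "f 0 0 = 0" "f 0 1 = 1" "f 0 2 = 0" "f 0 3 = 1"
      "f 1 0 = 1" "f 1 1 = 0" "f 1 2 = 0" "f 1 3 = 1"
      "f 2 0 = 0" "f 2 1 = 0" "f 2 2 = 1" "f 2 3 = 1"
    by (simp_all add: f_def p_def rotate_column_def transpose_def)
  have "{x \<in> {..<2 * k}. f s x = i} \<noteq> {x \<in> {..<2 * k}. f s' x = i'}"
    if s: "s < s'" "s' < 3" and i: "i < 2" "i' < 2" for s s' i i'
  proof
    assume fibres_eq: "{x \<in> {..<2 * k}. f s x = i} = {x \<in> {..<2 * k}. f s' x = i'}"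
    have eq: "f s x = i \<longleftrightarrow> f s' x = i'" if "x < 4" for x
    proof -
      have "x \<in> {..<2 * k}" using that assms by simp
      then show ?thesis using fibres_eq by blast
    qed
    have "s = 0 \<and> s' = 1 \<or> s = 0 \<and> s' = 2 \<or> s = 1 \<and> s' = 2"
      using s by linarith
    moreover have "i = 0 \<or> i = 1" "i' = 0 \<or> i' = 1" using i by linarith+
    ultimately show False
      using eq[of 0] eq[of 1] eq[of 2] eq[of 3] vals by auto
  qed
  \<comment> \<open>The exchanged points 1 and 2 both lie below \<open>2 * k\<close> because
    \<open>2 \<le> k\<close>.\<close>
  moreover have "bij_betw (p s) {..<2 * k} {..<2 * k}" for s
    using assms bij_betw_rotate_column[of k 2 s] by (auto simp: p_def bij_betw_def)
  then have "card {x \<in> {..<2 * k}. f s x = i} = k" if "i < 2" for s i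
    unfolding f_def using that by (rule card_residue_class_permuted)
  moreover have "f s x < 2" for s x
    by (simp add: f_def)
  ultimately show ?thesis
    using assms steiner_way_trade_fibres[of "{..<2 * k}" k 3 f 2] by auto
qed

text \<open>Balance at \<open>{x}\<close> says that \<open>x\<close> lies in the only block of
  \<open>T 0\<close> iff it lies in the only block of \<open>T 1\<close>. The two blocks then
  coincide, although \<open>T 0\<close> and \<open>T 1\<close> are disjoint.\<close>

lemma steiner_way_trade_volume_neq_1:
  assumes "steiner_way_trade \<mu> V k 1 m T" "2 \<le> \<mu>"
  shows "m \<noteq> 1"
proof
  assume "m = 1"
  from assms have tr: "way_trade \<mu> V k 1 m T" by (simp add: steiner_way_trade_def)
  with \<open>m = 1\<close> assms(2) have "card (T 0) = 1" "card (T 1) = 1"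
    by (auto simp: way_trade_def)
  then obtain A B where AB: "T 0 = {A}" "T 1 = {B}"
    by (meson card_1_singletonE)
  have "T i \<subseteq> nsets V k" if "i < \<mu>" for i
    using tr that by (simp add: way_trade_def)
  from this[of 0] this[of 1] have sub: "A \<subseteq> V" "B \<subseteq> V"
    using AB assms(2) by (auto simp: nsets_def)
  have "x \<in> A \<longleftrightarrow> x \<in> B" if "x \<in> V" for x
  proof -
    have "{x} \<in> nsets V 1" using that by (simp add: nsets_def)
    then have "card {C \<in> T 0. {x} \<subseteq> C} = card {C \<in> T 1. {x} \<subseteq> C}"
      using tr assms(2) unfolding way_trade_def by force
    then have "card {C. C = A \<and> x \<in> C} = card {C. C = B \<and> x \<in> C}"
      unfolding AB by simp
    then show ?thesis
      by (cases "x \<in> A"; cases "x \<in> B") (auto simp: conj_commute cong: conj_cong)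
  qed
  with sub have "A = B" by blast
  moreover have "T 0 \<inter> T 1 = {}"
    using tr assms(2) unfolding way_trade_def disjoint_family_on_def by simp
  ultimately show False using AB by simp
qed

theorem theorem3p4:
  fixes k :: nat
  assumes "k \<ge> 2"
  shows "steiner_volumes 3 1 k = {1..} - {1}"
proof (intro equalityI subsetI)
  fix m assume "m \<in> steiner_volumes 3 1 k"
  then show "m \<in> {1..} - {1}"
    using steiner_way_trade_volume_neq_1[of 3] by (fastforce simp: steiner_volumes_def)
next
  fix m :: nat assume "m \<in> {1..} - {1}"
  then have "m = 2 \<or> 3 \<le> m" by auto
  then have "\<exists>T. steiner_way_trade 3 {..<m * k} k 1 m T"
    using steiner_way_trade_volume_two steiner_way_trade_rotations assms by blast
  with \<open>m \<in> {1..} - {1}\<close> show "m \<in> steiner_volumes 3 1 k"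
    by (auto simp: steiner_volumes_def)
qed

end
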